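(* Let $\Sigma_1$ be the system on $\mathbb{R}^2$ with inputs $u=(u_1,u_2)\in\mathbb{R}^2$ given by $$\dot x_1=|x_1|\,(-x_1+|x_2|+u_1),\qquad \dot x_2=x_2\,(-x_1-|x_2|+u_2),$$ and let $V_1:\mathbb{R}^2\to\mathbb{R}_{\ge 0}$, $V_1(x)=2|x_1|+2|x_2|$. Then $V_1\in\mathcal{W}_\infty(\Sigma_1,1)$. On the other hand, if $V$ is any $\mathcal{C}^1_0$ function in $\mathcal{W}(\Sigma_1,1)$, then $V$ is not positive definite and $V$ is not proper.
   Context: Notation: $|\cdot|$ is the Euclidean norm. For $V:\mathbb{R}^n\to\mathbb{R}$ and $x\in\mathbb{R}^n$, the viscosity subdifferential $\partial_D V(x)$ is the (possibly empty) set of all $\zeta\in\mathbb{R}^n$ such that $$\liminf_{h\to 0}\frac{1}{|h|}\left[V(x+h)-V(x)-\zeta\cdot h\right]\ge 0 .$$ For a system $\Sigma:\ \dot x=F(x,u)$ with $x\in\mathbb{R}^n$, $u\in\mathcal{U}$, and $\gamma\ge 0$, $\mathcal{W}(\Sigma,\gamma)$ is the set of all continuous $V:\mathbb{R}^n\to\mathbb{R}_{\ge0}$ such that $$\zeta\cdot F(x,u)\le -|x|^2+\gamma|u|^2\quad\text{for all }x\in\mathbb{R}^n\setminus\{0\},\ u\in\mathcal{U},\ \zeta\in\partial_D V(x).$$ A continuous $V:\mathbb{R}^n\to\mathbb{R}_{\ge0}$ is proper if $\{x: V(x)\le a\}$ is compact for every $a>0$, and positive definite if $V(x)=0$ if and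 only if $x=0$. $\mathcal{W}_\infty(\Sigma,\gamma)$ is the set of $V\in\mathcal{W}(\Sigma,\gamma)$ that are proper and positive definite. $\mathcal{C}^1_0$ is the set of continuous functions $V:\mathbb{R}^n\to\mathbb{R}_{\ge0}$ whose restriction to $\mathbb{R}^n\setminus\{0\}$ is continuously differentiable. Here $n=2$ and $\mathcal{U}=\mathbb{R}^2$. *)

theory Defs
  imports "HOL-Analysis.Analysis"
begin

definition viscosity_subdifferential ::
    "('a::euclidean_space \<Rightarrow> real) \<Rightarrow> 'a \<Rightarrow> 'a set" where
  "viscosity_subdifferential V x =
     {\<zeta>. Liminf (at 0) (\<lambda>h. ereal (1 / norm h * (V (x + h) - V x - \<zeta> \<bullet> h))) \<ge> 0}"

definition cont_nonneg :: "('a::euclidean_space \<Rightarrow> real) \<Rightarrow> bool" where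
  "cont_nonneg V \<longleftrightarrow> continuous_on UNIV V \<and> (\<forall>x. V x \<ge> 0)"

text \<open>A system with state space \<^typ>\<open>'a\<close> is given by its right-hand side \<open>F\<close>
  and its set \<open>U\<close> of input values.\<close>

definition W_class ::
    "('a::euclidean_space \<Rightarrow> 'b::euclidean_space \<Rightarrow> 'a) \<Rightarrow> 'b set \<Rightarrow> real \<Rightarrow> ('a \<Rightarrow> real) set" where
  "W_class F U \<gamma> =
     {V. cont_nonneg V \<and>
         (\<forall>x u \<zeta>. x \<noteq> 0 \<longrightarrow> u \<in> U \<longrightarrow> \<zeta> \<in> viscosity_subdifferential V x \<longrightarrow>
            \<zeta> \<bullet> F x u \<le> - (norm x)\<^sup>2 + \<gamma> * (norm u)\<^sup>2)}"

definition proper_fun :: "('a::euclidean_space \<Rightarrow> real) \<Rightarrow> bool" where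
  "proper_fun V \<longleftrightarrow> (\<forall>a>0. compact {x. V x \<le> a})"

definition pos_definite :: "('a::euclidean_space \<Rightarrow> real) \<Rightarrow> bool" where
  "pos_definite V \<longleftrightarrow> (\<forall>x. V x = 0 \<longleftrightarrow> x = 0)"

definition W_infinity ::
    "('a::euclidean_space \<Rightarrow> 'b::euclidean_space \<Rightarrow> 'a) \<Rightarrow> 'b set \<Rightarrow> real \<Rightarrow> ('a \<Rightarrow> real) set" where
  "W_infinity F U \<gamma> = {V \<in> W_class F U \<gamma>. proper_fun V \<and> pos_definite V}"

definition C1_0 :: "('a::euclidean_space \<Rightarrow> real) set" where
  "C1_0 = {V. cont_nonneg V \<and>
      (\<exists>g. (\<forall>x. x \<noteq> 0 \<longrightarrow> GDERIV V x :> g x) \<and> continuous_on (- {0}) g)}"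

definition Sigma1 :: "real ^ 2 \<Rightarrow> real ^ 2 \<Rightarrow> real ^ 2" where
  "Sigma1 x u = vector [\<bar>x $ 1\<bar> * (- (x $ 1) + \<bar>x $ 2\<bar> + u $ 1),
                        x $ 2 * (- (x $ 1) - \<bar>x $ 2\<bar> + u $ 2)]"

definition V1 :: "real ^ 2 \<Rightarrow> real" where
  "V1 x = 2 * \<bar>x $ 1\<bar> + 2 * \<bar>x $ 2\<bar>"

end

theory Submission
  imports Defs
begin

text \<open>For every subgradient \<open>\<zeta>\<close> of \<open>V\<^sub>1\<close> one has \<open>\<zeta>\<^sub>1 \<bar>x\<^sub>1\<bar> = 2 x\<^sub>1\<close> and
  \<open>\<zeta>\<^sub>2 x\<^sub>2 = 2 \<bar>x\<^sub>2\<bar>\<close>; on the axes, where \<open>V\<^sub>1\<close> is not differentiable, both sides vanish.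
  The dissipation inequality then reduces to \<open>2 x\<^sub>1 u\<^sub>1 + 2 \<bar>x\<^sub>2\<bar> u\<^sub>2 \<le> |x|\<^sup>2 + |u|\<^sup>2\<close>.

  Conversely, \<open>W(\<Sigma>\<^sub>1, 1)\<close> contains no \<open>C\<^sup>1\<^sub>0\<close> function at all. Let \<open>(a, b)\<close> be the gradient of
  such a function at \<open>(1, t)\<close> with \<open>0 < \<bar>t\<bar> \<le> 1\<close>. The choice \<open>u = (a/2, b t/2)\<close> of the input,
  which is the worst one, yields \<open>b t (1 + \<bar>t\<bar>) \<ge> 2 \<bar>t\<bar>\<close>. Hence \<open>b \<ge> 1\<close> for \<open>t > 0\<close> and
  \<open>b \<le> -1\<close> for \<open>t < 0\<close>, so the gradient is discontinuous at \<open>(1, 0)\<close>.\<close>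

lemma viscosity_subdifferential_eventually:
  fixes V :: "'a::euclidean_space \<Rightarrow> real"
  assumes "\<zeta> \<in> viscosity_subdifferential V x" and "\<epsilon> > 0"
  shows "eventually (\<lambda>h. V (x + h) - V x - \<zeta> \<bullet> h \<ge> - \<epsilon> * norm h) (at 0)"
proof -
  have "\<forall>\<^sub>F h in at 0. y < ereal (1 / norm h * (V (x + h) - V x - \<zeta> \<bullet> h))"
    if "y < 0" for y
    using assms(1) that unfolding viscosity_subdifferential_def le_Liminf_iff by blast
  from this[of "ereal (- \<epsilon>)"]
  have "\<forall>\<^sub>F h in at 0. - \<epsilon> < 1 / norm h * (V (x + h) - V x - \<zeta> \<bullet> h)"
    using assms(2) by simp
  moreover have "eventually (\<lambda>h::'a. h \<noteq> 0) (at 0)"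
    by (simp add: eventually_at_filter)
  ultimately show ?thesis
    by eventually_elim (simp add: field_simps)
qed

text \<open>The defining inequality is one-sided in \<open>V\<close>, but along a line
  \<open>h\<close> may be taken with either sign, and this pins down
  \<open>\<zeta> \<bullet> e\<close>. Differentiability along \<open>e\<close> alone suffices, which
  matters for \<open>V1\<close> on the axes.\<close>

lemma viscosity_subdifferential_inner_eq:
  fixes V :: "'a::euclidean_space \<Rightarrow> real"
  assumes \<zeta>: "\<zeta> \<in> viscosity_subdifferential V x"
    and D: "((\<lambda>t. V (x + t *\<^sub>R e)) has_real_derivative D) (at 0)"
    and e: "norm e = 1"
  shows "\<zeta> \<bullet> e = D"
proof -
  define c where "c = D - \<zeta> \<bullet> e"
  define \<phi> where "\<phi> t = V (x + t *\<^sub>R e) - V x - t * (\<zeta> \<bullet> e)" for t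
  have "(\<phi> has_real_derivative c) (at 0)"
    unfolding \<phi>_def c_def by (auto intro!: derivative_eq_intros D)
  then have lim: "((\<lambda>t. \<phi> t / t) \<longlongrightarrow> c) (at 0)"
    by (simp add: has_field_derivative_iff \<phi>_def)
  \<comment> \<open>The subgradient estimate holds on a punctured neighbourhood, so
    \<open>t *\<^sub>R e\<close> has to avoid 0.\<close>
  have "filterlim (\<lambda>t. t *\<^sub>R e) (at 0) (at 0)"
  proof (rule filterlim_atI)
    show "((\<lambda>t. t *\<^sub>R e) \<longlongrightarrow> 0) (at 0)"
      by (auto intro!: tendsto_eq_intros)
    show "\<forall>\<^sub>F t in at 0. t *\<^sub>R e \<noteq> 0"
      using e by (auto simp: eventually_at_filter)
  qed
  then have ev: "\<forall>\<^sub>F t in at 0. \<phi> t \<ge> - \<epsilon> * \<bar>t\<bar>" if "\<epsilon> > 0" for \<epsilon>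
    using eventually_compose_filterlim[OF viscosity_subdifferential_eventually[OF \<zeta> that]] e
    by (fastforce simp: \<phi>_def)
  \<comment> \<open>Dividing the lower bound on \<open>\<phi> t\<close> by \<open>t < 0\<close>
    reverses it: the left limit bounds \<open>c\<close> from above, the right limit from
    below.\<close>
  have le: "\<bar>c\<bar> \<le> \<epsilon>" if "\<epsilon> > 0" for \<epsilon>
  proof (rule abs_leI)
    have "\<forall>\<^sub>F t in at_left 0. \<phi> t / t \<le> \<epsilon>"
      unfolding eventually_at_filter using ev[OF that, unfolded eventually_at_filter]
      by eventually_elim (auto simp: field_simps)
    then show "c \<le> \<epsilon>"
      using lim by (intro tendsto_upperbound[of "\<lambda>t. \<phi> t / t" c "at_left 0"])
        (auto simp: filterlim_at_split)
    have "\<forall>\<^sub>F t in at_right 0. - \<epsilon> \<le> \<phi> t / t"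
      unfolding eventually_at_filter using ev[OF that, unfolded eventually_at_filter]
      by eventually_elim (auto simp: field_simps)
    then have "- \<epsilon> \<le> c"
      using lim by (intro tendsto_lowerbound[of "\<lambda>t. \<phi> t / t" c "at_right 0"])
        (auto simp: filterlim_at_split)
    then show "- c \<le> \<epsilon>" by simp
  qed
  have "\<bar>c\<bar> \<le> 0"
    by (rule field_le_epsilon) (use le in simp)
  then show ?thesis by (simp add: c_def)
qed

text \<open>The quotient tends to 0, so its liminf is 0. This lets the inequality in
  \<open>W_class\<close> be applied to classical gradients.\<close>

lemma GDERIV_in_viscosity_subdifferential:
  fixes V :: "'a::euclidean_space \<Rightarrow> real"
  assumes "GDERIV V x :> g"
  shows "g \<in> viscosity_subdifferential V x"
proof -
  have "((\<lambda>h. norm (V (x + h) - V x - h \<bullet> g) / norm h) \<longlongrightarrow> 0) (at 0)"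
    using assms by (simp add: gderiv_def has_derivative_at)
  then have "((\<lambda>h. norm (1 / norm h * (V (x + h) - V x - g \<bullet> h))) \<longlongrightarrow> 0) (at 0)"
    by (simp add: inner_commute abs_mult)
  then have "((\<lambda>h. 1 / norm h * (V (x + h) - V x - g \<bullet> h)) \<longlongrightarrow> 0) (at 0)"
    by (rule tendsto_norm_zero_cancel)
  then have "Liminf (at 0) (\<lambda>h. ereal (1 / norm h * (V (x + h) - V x - g \<bullet> h))) = ereal 0"
    by (intro lim_imp_Liminf) auto
  then show ?thesis by (simp add: viscosity_subdifferential_def)
qed

lemma has_real_derivative_abs_shift:
  fixes a :: real
  assumes "a \<noteq> 0"
  shows "((\<lambda>t. \<bar>a + t\<bar>) has_real_derivative sgn a) (at 0)"
proof (rule DERIV_cong_ev[THEN iffD2, OF refl _ refl])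
  have "\<forall>\<^sub>F t in nhds 0. 0 < sgn a * (a + t)"
    using assms by (intro order_tendstoD[of _ "sgn a * (a + 0)"] tendsto_intros filterlim_ident)
      (auto simp: sgn_if)
  then show "\<forall>\<^sub>F t in nhds 0. \<bar>a + t\<bar> = sgn a * (a + t)"
    by eventually_elim (use assms in \<open>auto simp: sgn_if\<close>)
  show "((\<lambda>t. sgn a * (a + t)) has_real_derivative sgn a) (at 0)"
    by (auto intro!: derivative_eq_intros)
qed

text \<open>If a coordinate is nonzero, \<open>V1\<close> is differentiable along its axis, whatever
  the other coordinate is. The factors \<open>\<bar>x $ 1\<bar>\<close> and \<open>x $ 2\<close> are
  those occurring in \<open>Sigma1\<close>; they absorb the case of a zero coordinate.\<close>

lemma V1_subgradient:
  assumes \<zeta>: "\<zeta> \<in> viscosity_subdifferential V1 x"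
  shows "\<zeta> $ 1 * \<bar>x $ 1\<bar> = 2 * x $ 1" and "\<zeta> $ 2 * x $ 2 = 2 * \<bar>x $ 2\<bar>"
proof -
  have "\<zeta> \<bullet> axis 1 1 = 2 * sgn (x $ 1)" if "x $ 1 \<noteq> 0"
  proof (rule viscosity_subdifferential_inner_eq[OF \<zeta>])
    show "((\<lambda>t. V1 (x + t *\<^sub>R axis 1 1)) has_real_derivative 2 * sgn (x $ 1)) (at 0)"
      unfolding V1_def
      by (auto intro!: derivative_eq_intros has_real_derivative_abs_shift that simp: axis_def)
  qed simp
  then show "\<zeta> $ 1 * \<bar>x $ 1\<bar> = 2 * x $ 1"
    by (cases "x $ 1 = 0") (auto simp: inner_axis sgn_if)
  have "\<zeta> \<bullet> axis 2 1 = 2 * sgn (x $ 2)" if "x $ 2 \<noteq> 0"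
  proof (rule viscosity_subdifferential_inner_eq[OF \<zeta>])
    show "((\<lambda>t. V1 (x + t *\<^sub>R axis 2 1)) has_real_derivative 2 * sgn (x $ 2)) (at 0)"
      unfolding V1_def
      by (auto intro!: derivative_eq_intros has_real_derivative_abs_shift that simp: axis_def)
  qed simp
  then show "\<zeta> $ 2 * x $ 2 = 2 * \<bar>x $ 2\<bar>"
    by (cases "x $ 2 = 0") (auto simp: inner_axis sgn_if)
qed

lemma continuous_on_V1: "continuous_on UNIV V1"
  unfolding V1_def by (intro continuous_intros)

lemma power2_norm_vec2: "(norm (x :: real ^ 2))\<^sup>2 = (x $ 1)\<^sup>2 + (x $ 2)\<^sup>2"
  by (simp add: norm_vec_def L2_set_def sum_2)

lemma V1_in_W_class: "V1 \<in> W_class Sigma1 UNIV 1"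
proof -
  have "\<zeta> \<bullet> Sigma1 x u \<le> - (norm x)\<^sup>2 + (norm u)\<^sup>2"
    if "\<zeta> \<in> viscosity_subdifferential V1 x" for x u \<zeta>
  proof -
    have "\<zeta> \<bullet> Sigma1 x u = (\<zeta> $ 1 * \<bar>x $ 1\<bar>) * (- (x $ 1) + \<bar>x $ 2\<bar> + u $ 1)
        + (\<zeta> $ 2 * x $ 2) * (- (x $ 1) - \<bar>x $ 2\<bar> + u $ 2)"
      by (simp add: Sigma1_def inner_vec_def sum_2)
    also have "\<dots> = 2 * x $ 1 * (- (x $ 1) + \<bar>x $ 2\<bar> + u $ 1)
        + 2 * \<bar>x $ 2\<bar> * (- (x $ 1) - \<bar>x $ 2\<bar> + u $ 2)"
      by (simp only: V1_subgradient[OF that])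
    \<comment> \<open>The mixed terms in \<open>x $ 1\<close> and \<open>\<bar>x $ 2\<bar>\<close>
      cancel; the rest is completed to squares.\<close>
    also have "\<dots> = - (x $ 1)\<^sup>2 - \<bar>x $ 2\<bar>\<^sup>2 + (u $ 1)\<^sup>2 + (u $ 2)\<^sup>2
        - (x $ 1 - u $ 1)\<^sup>2 - (\<bar>x $ 2\<bar> - u $ 2)\<^sup>2"
      by (simp only: power2_eq_square) algebra
    also have "\<dots> \<le> - (norm x)\<^sup>2 + (norm u)\<^sup>2"
      by (simp add: power2_norm_vec2)
    finally show ?thesis .
  qed
  then show ?thesis
    using continuous_on_V1 by (auto simp: W_class_def cont_nonneg_def V1_def)
qed

lemma proper_fun_V1: "proper_fun V1"
  unfolding proper_fun_def
proof (intro allI impI)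
  fix a :: real
  \<comment> \<open>\<open>V1\<close> is twice the l1 norm, which dominates the Euclidean
    norm.\<close>
  have "norm x \<le> a" if "V1 x \<le> a" for x
    using that norm_le_l1_cart[of x] by (simp add: V1_def sum_2)
  then have "bounded {x. V1 x \<le> a}"
    by (intro boundedI) auto
  moreover have "closed {x. V1 x \<le> a}"
    by (intro closed_Collect_le continuous_on_V1 continuous_on_const)
  ultimately show "compact {x. V1 x \<le> a}"
    by (simp add: compact_eq_bounded_closed)
qed

lemma pos_definite_V1: "pos_definite V1"
  by (auto simp: pos_definite_def V1_def vec_eq_iff forall_2)

lemma W_class_Sigma1_gradient_bound:
  assumes V: "V \<in> W_class Sigma1 UNIV 1"
    and t: "\<bar>t\<bar> \<le> 1"
    and g: "GDERIV V (vector [1, t]) :> g"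
  shows "\<bar>t\<bar> \<le> g $ 2 * t"
proof -
  define p where "p = g $ 1"
  define q where "q = g $ 2 * t"
  \<comment> \<open>At this point \<open>p\<close> and \<open>q\<close> are the coefficients of the
    inputs in \<open>g \<bullet> Sigma1\<close>, so \<open>u\<close> maximizes the concave quadratic
    \<open>p * u $ 1 + q * u $ 2 - (norm u)\<^sup>2\<close>.\<close>
  define u :: "real ^ 2" where "u = vector [p / 2, q / 2]"
  have "(vector [1, t] :: real ^ 2) \<noteq> 0"
    by (auto simp: vec_eq_iff forall_2)
  then have "g \<bullet> Sigma1 (vector [1, t]) u \<le> - (norm (vector [1, t] :: real ^ 2))\<^sup>2 + (norm u)\<^sup>2"
    using V GDERIV_in_viscosity_subdifferential[OF g] by (auto simp: W_class_def)
  then have "p * (- 1 + \<bar>t\<bar> + p / 2) + q * (- 1 - \<bar>t\<bar> + q / 2)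
      \<le> - 1 - \<bar>t\<bar>\<^sup>2 + (p / 2)\<^sup>2 + (q / 2)\<^sup>2"
    by (simp add: power2_norm_vec2 Sigma1_def inner_vec_def sum_2 u_def p_def q_def)
  \<comment> \<open>Completing the square in \<open>p\<close> eliminates this unknown; the constants
    leave \<open>1 + \<bar>t\<bar>\<^sup>2 - (1 - \<bar>t\<bar>)\<^sup>2 = 2 *
    \<bar>t\<bar>\<close>.\<close>
  moreover have "(p / 2)\<^sup>2 + (q / 2)\<^sup>2 + 1 + \<bar>t\<bar>\<^sup>2 - p * (1 - \<bar>t\<bar>) - q * (1 + \<bar>t\<bar>)
      = (p / 2 - (1 - \<bar>t\<bar>))\<^sup>2 + (q / 2)\<^sup>2 + 2 * \<bar>t\<bar> - q * (1 + \<bar>t\<bar>)"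
    by (simp add: power2_eq_square field_simps)
  ultimately have "(p / 2 - (1 - \<bar>t\<bar>))\<^sup>2 + (q / 2)\<^sup>2 + 2 * \<bar>t\<bar> \<le> q * (1 + \<bar>t\<bar>)"
    by (simp add: power2_eq_square field_simps)
  then have le: "2 * \<bar>t\<bar> \<le> q * (1 + \<bar>t\<bar>)"
    using zero_le_power2[of "p / 2 - (1 - \<bar>t\<bar>)"] zero_le_power2[of "q / 2"] by linarith
  then have "0 \<le> q"
    by (smt (verit) mult_neg_pos abs_ge_zero)
  then have "q * (1 + \<bar>t\<bar>) \<le> q * 2"
    using t by (intro mult_left_mono) auto
  then show ?thesis
    using le by (simp add: q_def)
qed

lemma C1_0_not_in_W_class_Sigma1:
  assumes C1: "V \<in> C1_0"
  shows "V \<notin> W_class Sigma1 UNIV 1"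
proof
  assume V: "V \<in> W_class Sigma1 UNIV 1"
  obtain g where g: "\<And>x. x \<noteq> 0 \<Longrightarrow> GDERIV V x :> g x" and cont: "continuous_on (- {0}) g"
    using C1 by (auto simp: C1_0_def)
  define f where "f t = g (vector [1, t]) $ 2" for t :: real
  have nz: "(vector [1, t] :: real ^ 2) \<noteq> 0" for t
    by (auto simp: vec_eq_iff forall_2)
  have bound: "\<bar>t\<bar> \<le> f t * t" if "\<bar>t\<bar> \<le> 1" for t
    unfolding f_def by (rule W_class_Sigma1_gradient_bound[OF V that g[OF nz]])
  have "((\<lambda>t. vector [1, t] :: real ^ 2) \<longlongrightarrow> vector [1, 0]) (at 0)"
  proof (rule vec_tendstoI)
    fix i :: 2
    show "((\<lambda>t. (vector [1, t] :: real ^ 2) $ i) \<longlongrightarrow> vector [1, 0] $ i) (at 0)"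
      using exhaust_2[of i] by (elim disjE) simp_all
  qed
  \<comment> \<open>The limit point lies on the axis but away from the origin, where
    \<open>g\<close> is continuous.\<close>
  moreover have "isCont g (vector [1, 0])"
    using cont nz by (simp add: continuous_on_eq_continuous_at open_Compl)
  ultimately have "((\<lambda>t. g (vector [1, t])) \<longlongrightarrow> g (vector [1, 0])) (at 0)"
    by (rule isCont_tendsto_compose[rotated])
  then have "(f \<longlongrightarrow> f 0) (at 0)"
    unfolding f_def by (rule tendsto_vec_nth)
  then have lim: "(f \<longlongrightarrow> f 0) (at_left 0)" "(f \<longlongrightarrow> f 0) (at_right 0)"
    by (simp_all add: filterlim_at_split)
  have "\<forall>\<^sub>F t in at_left 0. f t \<le> - 1"
    using eventually_at_left_real[of "-1" "0::real", simplified]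
  proof eventually_elim
    case (elim t)
    then show ?case
      using bound[of t] mult_le_cancel_right_neg[of t "-1" "f t"] by simp
  qed
  then have "f 0 \<le> - 1"
    by (intro tendsto_upperbound[OF lim(1)]) simp_all
  have "\<forall>\<^sub>F t in at_right 0. 1 \<le> f t"
    using eventually_at_right_real[of "0::real" 1, simplified]
  proof eventually_elim
    case (elim t)
    then show ?case
      using bound[of t] mult_le_cancel_right_pos[of t 1 "f t"] by simp
  qed
  then have "1 \<le> f 0"
    by (intro tendsto_lowerbound[OF lim(2)]) simp_all
  with \<open>f 0 \<le> - 1\<close> show False by simp
qed

theorem proposition2p2:
  shows "V1 \<in> W_infinity Sigma1 UNIV 1 \<and>
    (\<forall>V. V \<in> C1_0 \<longrightarrow> V \<in> W_class Sigma1 UNIV 1 \<longrightarrow>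
       \<not> pos_definite V \<and> \<not> proper_fun V)"
  \<comment> \<open>The second half holds vacuously: no \<open>V\<close> meets both
    premises.\<close>
  using V1_in_W_class proper_fun_V1 pos_definite_V1 C1_0_not_in_W_class_Sigma1
  by (auto simp: W_infinity_def)

end
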